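(* Assume the PETC system (see context) is globally exponentially stable (GES), and that there is a known constant $a$ with $0\le a<1$ such that every solution of it satisfies $V(\xi(t_{i+1}))\le aV(\xi(t_i))$. Then the system $\mathcal{S}_{\mathrm{S'}}$ with state set and initial state set $\mathcal{X}^{\mathrm{S'}}$, no inputs, transitions $$\mathcal{E}^{\mathrm{S'}}=\{(k\sigma,\sigma\sigma'): k\sigma,\ \sigma\sigma'\in\mathcal{X}^{\mathrm{S'}}\}$$ (where $k\in K$ is a single entry, $\sigma,\sigma'$ are finite sequences and $\sigma\sigma'$ is their concatenation), output set $\mathcal{Y}_{\mathrm{E}}$ and output map $H^{\mathrm{S}}$, simulates the traffic generated by the PETC system; that is, there is a simulation relation from the PETC traffic system to $\mathcal{S}_{\mathrm{S'}}$.
   Context: Plant and PETC. Let $A\in\mathbb{R}^{n_x\times n_x}$, $B\in\mathbb{R}^{n_x\times n_u}$, $K_{\mathrm{c}}\in\mathbb{R}^{n_u\times n_x}$, $h>0$, $\bar k\in\mathbb{N}$ ($\bar k\ge1$), and let $Q\in\mathbb{R}^{2n_x\times 2n_x}$ be symmetric. The plant is $\dot\xi(t)=A\xi(t)+BK_{\mathrm{c}}\hat\xi(t)$, $\xi(0)=\hat\xi(0)=x_0$, with zero-order hold $\hat\xi(t)=\xi(t_i)$ for $t\in[t_i,t_{i+1})$, $t_0=0$. For $k\in\mathbb{N}$ put $M(k)=e^{Ahk}+\int_0^{hk}e^{A\tau}\,d\tau\,BK_{\mathrm{c}}$ and $N(k)=\begin{bmatrix}M(k)\\ I\end{bmatrix}^{\mathsf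 T}Q\begin{bmatrix}M(k)\\ I\end{bmatrix}$. The discrete inter-event time is $\kappa(x)=\min\{k\in\{1,\dots,\bar k\}: x^{\mathsf T}N(k)x>0\text{ or }k=\bar k\}$. The PETC (periodic event-triggered control) system is the plant with $t_{i+1}=t_i+h\kappa(\xi(t_i))$. It is GES if there are $M<\infty$, $b>0$ such that $|\xi(t)|\le Me^{-bt}|\xi(0)|$ for every solution and every initial state. $V(x)=x^{\mathsf T}Px$ with $P$ symmetric positive definite. $\underline{k}:=\min\{k\in\{1,\dots,\bar k\}: N(k)\text{ is not negative semidefinite}\}$; $K:=\{\underline k,\dots,\bar k\}$. $r<1$ is a given contraction ratio and $N:=\lceil\log_a(r)\rceil$. $K^m$ is the set of sequences of length $m$ with entries in $K$, and $\mathbb{K}_N:=\bigcup_{i=1}^NK^i\cup\{\varepsilon\}$, $\varepsilon$ the empty sequence. $\mathcal{Y}_{\mathrm{E}}=\{h,2h,\dots,\bar kh,h_{\mathrm{P}}\}$, where $h_{\mathrm{P}}>0$ is a fixed number. $H^{\mathrm{S}}(k\sigma)=hk$ and $H^{\mathrm{S}}(\varepsilon)=h_{\mathrm{P}}$. Relation. Put $V_0=1$, $\mathcal{X}=\mathcal{X}_0=\{x\in\mathbb{R}^{n_x}:V(x)\le V_0\}$, $\mathcal{X}_{\mathrm{P}}=\{x\in\mathbb{R}^{n_x}:V(x)\le rV_0\}$. Let $\mathcal{K}_k=\{x\in\mathcal{X}:x^{\mathsf T}N(k)x>0\}$ for $k<\bar k$, $\mathcal{K}_{\bar k}=\mathcal{X}$,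 and $\mathcal{Q}_k=\mathcal{K}_k\cap\bigcap_{j=\underline k}^{k-1}\bar{\mathcal{K}}_j$, where the bar denotes complement. The relation $\mathcal{R}_{\mathrm{S'}}\subseteq\mathbb{R}^{n_x}\times\mathbb{K}_N$ is given by: $(x,k_1k_2\cdots k_m)\in\mathcal{R}_{\mathrm{S'}}$ iff $z:=x/\sqrt{V(x)}$ satisfies $z\in\mathcal{X}_0$, $z\in\mathcal{Q}_{k_1}$, $M(k_{i-1})\cdots M(k_1)z\in\mathcal{Q}_{k_i}$ for $i=2,\dots,m$, $z\notin\mathcal{X}_{\mathrm{P}}$, $M(k_i)\cdots M(k_1)z\notin\mathcal{X}_{\mathrm{P}}$ for $i=1,\dots,m-1$, and $M(k_m)\cdots M(k_1)z\in\mathcal{X}_{\mathrm{P}}$. $\mathcal{X}^{\mathrm{S'}}:=\{\sigma\in\mathbb{K}_N:(x,\sigma)\in\mathcal{R}_{\mathrm{S'}}\text{ for some }x\in\mathbb{R}^{n_x}\}$. Transition systems. An (autonomous) system is a tuple $(\mathcal{X},\mathcal{X}_0,\mathcal{E},\mathcal{Y},H)$ of states, initial states $\mathcal{X}_0\subseteq\mathcal{X}$, transitions $\mathcal{E}\subseteq\mathcal{X}\times\mathcal{X}$, outputs, and output map $H:\mathcal{X}\to\mathcal{Y}$. For systems $\mathcal{S}_a,\mathcal{S}_b$ with $\mathcal{Y}_a=\mathcal{Y}_b$, a relation $\mathcal{R}\subseteq\mathcal{X}_a\times\mathcal{X}_b$ is a simulation relation from $\mathcal{S}_a$ to $\mathcal{S}_b$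 if (i) every $x_{a0}\in\mathcal{X}_{a0}$ is related to some $x_{b0}\in\mathcal{X}_{b0}$; (ii) $(x_a,x_b)\in\mathcal{R}$ implies $H_a(x_a)=H_b(x_b)$; (iii) if $(x_a,x_b)\in\mathcal{R}$ and $(x_a,x_a')\in\mathcal{E}_a$, there is $(x_b,x_b')\in\mathcal{E}_b$ with $(x_a',x_b')\in\mathcal{R}$. PETC traffic system: states and initial states $\mathbb{R}^{n_x}$; transitions $\{(x,x')\in\mathbb{R}^{n_x}\times\mathbb{R}^{n_x}: x'=M(\kappa(x))x\}$; output set $\mathcal{Y}_{\mathrm{E}}$; output map $x\mapsto h\kappa(x)$.
   Formalization: The origin, where x/√V(x) is undefined and the claim can fail, is removed from the states, initial states and transitions of the PETC traffic system; r>0 is assumed, N:=1 when a=0, and k_low is read as k̄ when all N(k) are negative semidefinite. *)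

theory Defs
  imports "HOL-Analysis.Analysis"
begin

section \<open>Matrices\<close>

text \<open>The class-based exponential is not available here: \<open>*\<close> on \<open>real^'n^'n\<close> is the componentwise
  product, and the type is not a normed algebra under the matrix product \<open>**\<close>.\<close>

definition mat_power :: "real^'n^'n \<Rightarrow> nat \<Rightarrow> real^'n^'n" where
  "mat_power A k = (((**) A) ^^ k) (mat 1)"

definition mat_exp :: "real^'n^'n \<Rightarrow> real^'n^'n" where
  "mat_exp A = (\<Sum>k. (1 / fact k) *\<^sub>R mat_power A k)"

definition stack :: "real^'n^'n \<Rightarrow> real^'n^'n \<Rightarrow> real^'n^('n + 'n)" where
  "stack F G = (\<chi> i. case i of Inl j \<Rightarrow> F $ j | Inr j \<Rightarrow> G $ j)"

definition qform :: "real^'n^'n \<Rightarrow> real^'n \<Rightarrow> real" where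
  "qform P x = x \<bullet> (P *v x)"

definition symmetric_mat :: "real^'n^'n \<Rightarrow> bool" where
  "symmetric_mat P \<longleftrightarrow> transpose P = P"

definition pos_def :: "real^'n^'n \<Rightarrow> bool" where
  "pos_def P \<longleftrightarrow> (\<forall>x. x \<noteq> 0 \<longrightarrow> qform P x > 0)"

definition neg_semidef :: "real^'n^'n \<Rightarrow> bool" where
  "neg_semidef P \<longleftrightarrow> (\<forall>x. qform P x \<le> 0)"

section \<open>The sampled-data system\<close>

definition M_mat ::
  "real^'n^'n \<Rightarrow> real^'u^'n \<Rightarrow> real^'n^'u \<Rightarrow> real \<Rightarrow> nat \<Rightarrow> real^'n^'n" where
  "M_mat A B Kc h k =
     mat_exp ((h * real k) *\<^sub>R A)
     + integral {0..h * real k} (\<lambda>\<tau>. mat_exp (\<tau> *\<^sub>R A)) ** B ** Kc"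

definition N_mat ::
  "real^'n^'n \<Rightarrow> real^'u^'n \<Rightarrow> real^'n^'u \<Rightarrow> real \<Rightarrow> real^('n + 'n)^('n + 'n) \<Rightarrow> nat \<Rightarrow> real^'n^'n"
where
  "N_mat A B Kc h Q k =
     transpose (stack (M_mat A B Kc h k) (mat 1)) ** Q ** stack (M_mat A B Kc h k) (mat 1)"

definition kappa ::
  "real^'n^'n \<Rightarrow> real^'u^'n \<Rightarrow> real^'n^'u \<Rightarrow> real \<Rightarrow> nat \<Rightarrow> real^('n + 'n)^('n + 'n) \<Rightarrow> real^'n \<Rightarrow> nat"
where
  "kappa A B Kc h kbar Q x =
     Min {k \<in> {1..kbar}. qform (N_mat A B Kc h Q k) x > 0 \<or> k = kbar}"

text \<open>A solution consists of the state trajectory \<open>\<xi>\<close>, the held state \<open>\<xi>h\<close> and the sampling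
  times \<open>t\<close>; only times \<open>s \<ge> 0\<close> matter. The derivative within a sampling interval is
  two-sided in the interior and one-sided at the sampling instant, where \<open>\<xi>h\<close> jumps.\<close>

definition petc_solution ::
  "real^'n^'n \<Rightarrow> real^'u^'n \<Rightarrow> real^'n^'u \<Rightarrow> real \<Rightarrow> nat \<Rightarrow> real^('n + 'n)^('n + 'n)
   \<Rightarrow> (real \<Rightarrow> real^'n) \<Rightarrow> (real \<Rightarrow> real^'n) \<Rightarrow> (nat \<Rightarrow> real) \<Rightarrow> bool"
where
  "petc_solution A B Kc h kbar Q \<xi> \<xi>h t \<longleftrightarrow>
     t 0 = 0 \<and>
     (\<forall>i. t (Suc i) = t i + h * real (kappa A B Kc h kbar Q (\<xi> (t i)))) \<and>
     continuous_on {0..} \<xi> \<and>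
     (\<forall>i. \<forall>s\<in>{t i..<t (Suc i)}.
        \<xi>h s = \<xi> (t i) \<and>
        (\<xi> has_vector_derivative (A *v \<xi> s + (B ** Kc) *v \<xi>h s)) (at s within {t i..t (Suc i)}))"

definition petc_GES ::
  "real^'n^'n \<Rightarrow> real^'u^'n \<Rightarrow> real^'n^'u \<Rightarrow> real \<Rightarrow> nat \<Rightarrow> real^('n + 'n)^('n + 'n) \<Rightarrow> bool"
where
  "petc_GES A B Kc h kbar Q \<longleftrightarrow>
     (\<exists>M b. b > 0 \<and>
        (\<forall>\<xi> \<xi>h t. petc_solution A B Kc h kbar Q \<xi> \<xi>h t \<longrightarrow>
           (\<forall>s\<ge>0. norm (\<xi> s) \<le> M * exp (- b * s) * norm (\<xi> 0))))"

section \<open>Transition systems\<close>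

record ('s, 'y) tsystem =
  sys_states :: "'s set"
  sys_init :: "'s set"
  sys_edges :: "('s \<times> 's) set"
  sys_outputs :: "'y set"
  sys_map :: "'s \<Rightarrow> 'y"

definition is_system :: "('s, 'y) tsystem \<Rightarrow> bool" where
  "is_system S \<longleftrightarrow>
     sys_init S \<subseteq> sys_states S \<and>
     sys_edges S \<subseteq> sys_states S \<times> sys_states S \<and>
     sys_map S \<in> sys_states S \<rightarrow> sys_outputs S"

definition simulation_relation ::
  "('a \<times> 'b) set \<Rightarrow> ('a, 'y) tsystem \<Rightarrow> ('b, 'y) tsystem \<Rightarrow> bool" where
  "simulation_relation R Sa Sb \<longleftrightarrow>
     is_system Sa \<and> is_system Sb \<and> sys_outputs Sa = sys_outputs Sb \<and>
     R \<subseteq> sys_states Sa \<times> sys_states Sb \<and>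
     (\<forall>xa\<in>sys_init Sa. \<exists>xb\<in>sys_init Sb. (xa, xb) \<in> R) \<and>
     (\<forall>(xa, xb)\<in>R. sys_map Sa xa = sys_map Sb xb) \<and>
     (\<forall>(xa, xb)\<in>R. \<forall>xa'. (xa, xa') \<in> sys_edges Sa \<longrightarrow>
        (\<exists>xb'. (xb, xb') \<in> sys_edges Sb \<and> (xa', xb') \<in> R))"

definition restrict_system :: "('s, 'y) tsystem \<Rightarrow> 's set \<Rightarrow> ('s, 'y) tsystem" where
  "restrict_system S U =
     \<lparr>sys_states = sys_states S \<inter> U, sys_init = sys_init S \<inter> U,
      sys_edges = sys_edges S \<inter> (U \<times> U), sys_outputs = sys_outputs S, sys_map = sys_map S\<rparr>"

section \<open>The traffic system\<close>

definition out_set :: "real \<Rightarrow> nat \<Rightarrow> real \<Rightarrow> real set" where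
  "out_set h kbar hP = {h * real k | k. k \<in> {1..kbar}} \<union> {hP}"

definition petc_traffic ::
  "real^'n^'n \<Rightarrow> real^'u^'n \<Rightarrow> real^'n^'u \<Rightarrow> real \<Rightarrow> nat \<Rightarrow> real^('n + 'n)^('n + 'n) \<Rightarrow> real
   \<Rightarrow> (real^'n, real) tsystem"
where
  "petc_traffic A B Kc h kbar Q hP =
     \<lparr>sys_states = UNIV, sys_init = UNIV,
      sys_edges = {(x, x'). x' = M_mat A B Kc h (kappa A B Kc h kbar Q x) *v x},
      sys_outputs = out_set h kbar hP,
      sys_map = (\<lambda>x. h * real (kappa A B Kc h kbar Q x))\<rparr>"

text \<open>At the origin \<open>x / sqrt (V x)\<close> is undefined and \<open>kappa\<close> equals \<open>kbar\<close> whatever the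
  behaviour elsewhere, so the origin need not be matched by any abstract state: if \<open>N_mat\<close> is
  positive definite at \<open>1\<close> and \<open>kbar = 2\<close>, then \<open>kappa\<close> is \<open>1\<close> at every nonzero state, while the
  output at the origin is \<open>2 * h\<close>. The traffic is therefore considered on the nonzero states.\<close>

definition petc_traffic_nz ::
  "real^'n^'n \<Rightarrow> real^'u^'n \<Rightarrow> real^'n^'u \<Rightarrow> real \<Rightarrow> nat \<Rightarrow> real^('n + 'n)^('n + 'n) \<Rightarrow> real
   \<Rightarrow> (real^'n, real) tsystem"
where
  "petc_traffic_nz A B Kc h kbar Q hP =
     restrict_system (petc_traffic A B Kc h kbar Q hP) (- {0})"

section \<open>The abstraction\<close>

text \<open>If all \<open>N_mat\<close> are negative semidefinite, the minimum defining \<open>k_low\<close> would range over the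
  empty set; it is then \<open>kbar\<close>, the only inter-event time that occurs.\<close>

definition k_low ::
  "real^'n^'n \<Rightarrow> real^'u^'n \<Rightarrow> real^'n^'u \<Rightarrow> real \<Rightarrow> nat \<Rightarrow> real^('n + 'n)^('n + 'n) \<Rightarrow> nat"
where
  "k_low A B Kc h kbar Q =
     Min {k \<in> {1..kbar}. \<not> neg_semidef (N_mat A B Kc h Q k) \<or> k = kbar}"

definition K_set ::
  "real^'n^'n \<Rightarrow> real^'u^'n \<Rightarrow> real^'n^'u \<Rightarrow> real \<Rightarrow> nat \<Rightarrow> real^('n + 'n)^('n + 'n) \<Rightarrow> nat set"
where
  "K_set A B Kc h kbar Q = {k_low A B Kc h kbar Q..kbar}"

text \<open>For \<open>0 < a\<close> this is the ceiling of the logarithm of \<open>r\<close> to base \<open>a\<close>. For \<open>a = 0\<close>, where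
  that logarithm is undefined (and \<open>log 0 r = 0\<close> by totalization), it is the value
  for all sufficiently small positive \<open>a\<close>.\<close>

definition horizon :: "real \<Rightarrow> real \<Rightarrow> nat" where
  "horizon a r = (if a = 0 then 1 else nat \<lceil>log a r\<rceil>)"

definition KN_set :: "nat set \<Rightarrow> nat \<Rightarrow> nat list set" where
  "KN_set K N = (\<Union>i\<in>{1..N}. {\<sigma>. length \<sigma> = i \<and> set \<sigma> \<subseteq> K}) \<union> {[]}"

definition X0_set :: "real^'n^'n \<Rightarrow> (real^'n) set" where
  "X0_set P = {x. qform P x \<le> 1}"

definition XP_set :: "real^'n^'n \<Rightarrow> real \<Rightarrow> (real^'n) set" where
  "XP_set P r = {x. qform P x \<le> r}"

definition Kk_set ::
  "real^'n^'n \<Rightarrow> real^'u^'n \<Rightarrow> real^'n^'u \<Rightarrow> real \<Rightarrow> nat \<Rightarrow> real^('n + 'n)^('n + 'n) \<Rightarrow> real^'n^'n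
   \<Rightarrow> nat \<Rightarrow> (real^'n) set"
where
  "Kk_set A B Kc h kbar Q P k =
     (if k < kbar then {x \<in> X0_set P. qform (N_mat A B Kc h Q k) x > 0} else X0_set P)"

definition Qk_set ::
  "real^'n^'n \<Rightarrow> real^'u^'n \<Rightarrow> real^'n^'u \<Rightarrow> real \<Rightarrow> nat \<Rightarrow> real^('n + 'n)^('n + 'n) \<Rightarrow> real^'n^'n
   \<Rightarrow> nat \<Rightarrow> (real^'n) set"
where
  "Qk_set A B Kc h kbar Q P k =
     Kk_set A B Kc h kbar Q P k \<inter>
     (\<Inter>j\<in>{k_low A B Kc h kbar Q..<k}. - Kk_set A B Kc h kbar Q P j)"

text \<open>\<open>propagate \<dots> [k\<^sub>1, \<dots>, k\<^sub>m] z = M(k\<^sub>m) \<dots> M(k\<^sub>1) z\<close>\<close>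

definition propagate ::
  "real^'n^'n \<Rightarrow> real^'u^'n \<Rightarrow> real^'n^'u \<Rightarrow> real \<Rightarrow> nat list \<Rightarrow> real^'n \<Rightarrow> real^'n" where
  "propagate A B Kc h \<sigma> z = foldl (\<lambda>w k. M_mat A B Kc h k *v w) z \<sigma>"

text \<open>List indices start at 0, so \<open>take i \<sigma>\<close> are the entries strictly before \<open>\<sigma> ! i\<close>, and
  \<open>i = 0\<close> gives the conditions on \<open>z\<close> itself. The first conjunct on \<open>XP_set\<close> is subsumed by the
  quantified one unless \<open>\<sigma> = []\<close>; it makes the empty sequence unrelated to any state. With \<open>x = 0\<close>
  one gets \<open>z = 0 \<in> XP_set P r\<close>, so the origin is unrelated as well.\<close>

definition R_rel ::
  "real^'n^'n \<Rightarrow> real^'u^'n \<Rightarrow> real^'n^'u \<Rightarrow> real \<Rightarrow> nat \<Rightarrow> real^('n + 'n)^('n + 'n) \<Rightarrow> real^'n^'n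
   \<Rightarrow> real \<Rightarrow> real \<Rightarrow> ((real^'n) \<times> nat list) set"
where
  "R_rel A B Kc h kbar Q P a r =
     {(x, \<sigma>). \<sigma> \<in> KN_set (K_set A B Kc h kbar Q) (horizon a r) \<and>
        (let z = x /\<^sub>R sqrt (qform P x) in
           z \<in> X0_set P \<and>
           (\<forall>i<length \<sigma>. propagate A B Kc h (take i \<sigma>) z \<in> Qk_set A B Kc h kbar Q P (\<sigma> ! i)) \<and>
           z \<notin> XP_set P r \<and>
           (\<forall>i<length \<sigma>. propagate A B Kc h (take i \<sigma>) z \<notin> XP_set P r) \<and>
           propagate A B Kc h \<sigma> z \<in> XP_set P r)}"

definition XS_set ::
  "real^'n^'n \<Rightarrow> real^'u^'n \<Rightarrow> real^'n^'u \<Rightarrow> real \<Rightarrow> nat \<Rightarrow> real^('n + 'n)^('n + 'n) \<Rightarrow> real^'n^'n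
   \<Rightarrow> real \<Rightarrow> real \<Rightarrow> nat list set"
where
  "XS_set A B Kc h kbar Q P a r =
     {\<sigma> \<in> KN_set (K_set A B Kc h kbar Q) (horizon a r).
        \<exists>x. (x, \<sigma>) \<in> R_rel A B Kc h kbar Q P a r}"

fun HS :: "real \<Rightarrow> real \<Rightarrow> nat list \<Rightarrow> real" where
  "HS h hP [] = hP"
| "HS h hP (k # \<sigma>) = h * real k"

definition S_abs ::
  "real^'n^'n \<Rightarrow> real^'u^'n \<Rightarrow> real^'n^'u \<Rightarrow> real \<Rightarrow> nat \<Rightarrow> real^('n + 'n)^('n + 'n) \<Rightarrow> real^'n^'n
   \<Rightarrow> real \<Rightarrow> real \<Rightarrow> real \<Rightarrow> (nat list, real) tsystem"
where
  "S_abs A B Kc h kbar Q P a r hP =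
     (let X = XS_set A B Kc h kbar Q P a r in
      \<lparr>sys_states = X, sys_init = X,
       sys_edges = {(k # \<sigma>, \<sigma> @ \<sigma>') | k \<sigma> \<sigma>'.
          k \<in> K_set A B Kc h kbar Q \<and> k # \<sigma> \<in> X \<and> \<sigma> @ \<sigma>' \<in> X},
       sys_outputs = out_set h kbar hP,
       sys_map = HS h hP\<rparr>)"

end

theory Submission
  imports Defs
begin

text \<open>A nonzero state \<open>x\<close> is related to exactly one sequence: its consecutive inter-event times up to
  the first sample at which the Lyapunov function has dropped to \<open>r\<close> times its value at \<open>x\<close>. That
  sample comes after at least one and at most \<open>horizon a r\<close> events, since the function contracts by
  \<open>a\<close> at each event. For the successor \<open>x'\<close> of \<open>x\<close> the threshold is no larger, so its sequence cannot
  stop before the tail of the sequence of \<open>x\<close> does; both list the same inter-event times, hence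
  the tail is a prefix of the sequence of \<open>x'\<close>. The contraction is assumed for solutions in continuous
  time only; to transfer it to the sampled dynamics, a solution from each initial state is obtained by
  gluing the flows under a held input.\<close>

section \<open>The matrix exponential\<close>

lemma mat_power_0 [simp]: "mat_power A 0 = mat 1"
  by (simp add: mat_power_def)

lemma mat_power_Suc: "mat_power A (Suc k) = A ** mat_power A k"
  by (simp add: mat_power_def)

lemma mat_power_scaleR: "mat_power (c *\<^sub>R A) k = c ^ k *\<^sub>R mat_power A k"
  by (induction k)
    (simp_all add: mat_power_Suc scalar_matrix_assoc[symmetric] matrix_scalar_ac)

lemma abs_mat_power_le:
  fixes A :: "real^'n^'n"
  shows "\<bar>mat_power A k $ i $ j\<bar> \<le> (\<Sum>i\<in>UNIV. \<Sum>j\<in>UNIV. \<bar>A $ i $ j\<bar>) ^ k"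
proof (induction k arbitrary: i)
  case 0
  show ?case by (simp add: mat_def)
next
  case (Suc k)
  define c where "c = (\<Sum>i\<in>UNIV. \<Sum>j\<in>UNIV. \<bar>A $ i $ j\<bar>)"
  have c0: "0 \<le> c" by (simp add: c_def sum_nonneg)
  have "\<bar>mat_power A (Suc k) $ i $ j\<bar> \<le> (\<Sum>l\<in>UNIV. \<bar>A $ i $ l\<bar> * \<bar>mat_power A k $ l $ j\<bar>)"
    by (simp add: mat_power_Suc matrix_matrix_mult_def abs_mult[symmetric])
  also have "\<dots> \<le> (\<Sum>l\<in>UNIV. \<bar>A $ i $ l\<bar> * c ^ k)"
    by (intro sum_mono mult_left_mono) (use Suc in \<open>auto simp: c_def\<close>)
  also have "\<dots> = (\<Sum>l\<in>UNIV. \<bar>A $ i $ l\<bar>) * c ^ k"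
    by (simp add: sum_distrib_right)
  also have "\<dots> \<le> c * c ^ k"
  proof (rule mult_right_mono)
    show "(\<Sum>l\<in>UNIV. \<bar>A $ i $ l\<bar>) \<le> c"
      unfolding c_def by (rule member_le_sum[of i UNIV]) (auto intro: sum_nonneg)
  qed (use c0 in simp)
  finally show ?case by (simp add: c_def)
qed

definition exp_coeff :: "real^'n^'n \<Rightarrow> 'n \<Rightarrow> 'n \<Rightarrow> nat \<Rightarrow> real" where
  "exp_coeff A i j k = mat_power A k $ i $ j / fact k"

lemma summable_exp_coeff: "summable (\<lambda>k. exp_coeff A i j k * t ^ k)"
proof (rule summable_comparison_test)
  define c where "c = (\<Sum>i\<in>UNIV. \<Sum>j\<in>UNIV. \<bar>A $ i $ j\<bar>)"
  show "summable (\<lambda>k. (c * \<bar>t\<bar>) ^ k / fact k)"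
    using summable_exp[of "c * \<bar>t\<bar>"] by (simp add: field_simps)
  show "\<exists>N. \<forall>k\<ge>N. norm (exp_coeff A i j k * t ^ k) \<le> (c * \<bar>t\<bar>) ^ k / fact k"
    using abs_mat_power_le[of A _ i j]
    by (auto simp: exp_coeff_def c_def abs_mult power_abs power_mult_distrib
        intro!: divide_right_mono mult_right_mono)
qed

lemma mat_exp_nth: "mat_exp (t *\<^sub>R A) $ i $ j = (\<Sum>k. exp_coeff A i j k * t ^ k)"
proof -
  have "(\<lambda>k. (1 / fact k) *\<^sub>R mat_power (t *\<^sub>R A) k) sums
      (\<chi> i j. \<Sum>k. exp_coeff A i j k * t ^ k)"
    unfolding sums_def
  proof (intro vec_tendstoI)
    fix i j
    show "(\<lambda>n. (\<Sum>k<n. (1 / fact k) *\<^sub>R mat_power (t *\<^sub>R A) k) $ i $ j) \<longlonglongrightarrow>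
        (\<chi> i j. \<Sum>k. exp_coeff A i j k * t ^ k) $ i $ j"
      using summable_LIMSEQ[OF summable_exp_coeff[of A i j t]]
      by (simp add: mat_power_scaleR exp_coeff_def mult_ac)
  qed
  then show ?thesis
    by (simp add: mat_exp_def sums_iff)
qed

lemma mat_exp_0 [simp]: "mat_exp (0 :: real^'n^'n) = mat 1"
proof -
  have "mat_exp (0 *\<^sub>R (0 :: real^'n^'n)) $ i $ j = mat 1 $ i $ j" for i j :: 'n
    unfolding mat_exp_nth powser_zero by (simp add: exp_coeff_def)
  then show ?thesis
    by (simp add: vec_eq_iff)
qed

lemma has_vector_derivative_matrixI:
  fixes F :: "real \<Rightarrow> real^'m^'n"
  assumes "\<And>i j. ((\<lambda>t. F t $ i $ j) has_vector_derivative F' $ i $ j) (at t within S)"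
  shows "(F has_vector_derivative F') (at t within S)"
  using assms unfolding has_vector_derivative_def
  by (subst has_derivative_componentwise_within) (auto simp: Basis_vec_def inner_axis)

lemma diffs_exp_coeff: "diffs (exp_coeff A i j) k = (\<Sum>l\<in>UNIV. A $ i $ l * exp_coeff A l j k)"
proof -
  have "diffs (exp_coeff A i j) k = mat_power A (Suc k) $ i $ j / fact k"
    by (simp add: diffs_def exp_coeff_def field_simps del: of_nat_Suc)
  then show ?thesis
    by (simp add: mat_power_Suc matrix_matrix_mult_def exp_coeff_def sum_divide_distrib)
qed

lemma mat_exp_has_vector_derivative:
  "((\<lambda>t. mat_exp (t *\<^sub>R A)) has_vector_derivative A ** mat_exp (t *\<^sub>R A)) (at t within S)"
proof (rule has_vector_derivative_matrixI)
  fix i j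
  have "(\<Sum>k. diffs (exp_coeff A i j) k * t ^ k)
      = (\<Sum>k. \<Sum>l\<in>UNIV. A $ i $ l * (exp_coeff A l j k * t ^ k))"
    by (simp add: diffs_exp_coeff sum_distrib_right mult.assoc)
  also have "\<dots> = (\<Sum>l\<in>UNIV. \<Sum>k. A $ i $ l * (exp_coeff A l j k * t ^ k))"
    by (intro suminf_sum summable_mult summable_exp_coeff)
  also have "\<dots> = (A ** mat_exp (t *\<^sub>R A)) $ i $ j"
    by (simp add: matrix_matrix_mult_def mat_exp_nth suminf_mult summable_exp_coeff)
  finally show "((\<lambda>t. mat_exp (t *\<^sub>R A) $ i $ j) has_vector_derivative
      (A ** mat_exp (t *\<^sub>R A)) $ i $ j) (at t within S)"
    using termdiffs_strong_converges_everywhere[OF summable_exp_coeff[of A i j], of t]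
    by (simp add: mat_exp_nth has_real_derivative_iff_has_vector_derivative
        has_vector_derivative_at_within)
qed

lemma continuous_on_mat_exp: "continuous_on S (\<lambda>t. mat_exp (t *\<^sub>R A))"
  using mat_exp_has_vector_derivative
  by (auto intro: has_vector_derivative_continuous simp: continuous_on_eq_continuous_within)

lemma bounded_linear_matrix_mul_left: "bounded_linear (\<lambda>X. A ** X)"
  for A :: "real^'m^'n"
  by (simp flip: linear_conv_bounded_linear add: linear_iff matrix_add_ldistrib
      scalar_matrix_assoc[symmetric] matrix_scalar_ac)

lemma bounded_linear_matrix_mul_right: "bounded_linear (\<lambda>X. X ** A)"
  for A :: "real^'m^'n"
  by (simp flip: linear_conv_bounded_linear add: linear_iff scalar_matrix_assoc[symmetric])
    (simp add: matrix_matrix_mult_def vec_eq_iff distrib_right sum.distrib)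

lemma bounded_linear_matrix_vector_mul_left: "bounded_linear (\<lambda>X. X *v x)"
  for x :: "real^'n"
  by (simp flip: linear_conv_bounded_linear add: linear_iff matrix_vector_mult_add_rdistrib
      scaleR_matrix_vector_assoc)

section \<open>The flow under a held input\<close>

definition hold_flow :: "real^'n^'n \<Rightarrow> real^'n^'n \<Rightarrow> real \<Rightarrow> real^'n^'n" where
  "hold_flow A D t = mat_exp (t *\<^sub>R A) + integral {0..t} (\<lambda>\<tau>. mat_exp (\<tau> *\<^sub>R A)) ** D"

lemma hold_flow_0 [simp]: "hold_flow A D 0 = mat 1"
  by (simp add: hold_flow_def)

lemma M_mat_eq_hold_flow: "M_mat A B Kc h k = hold_flow A (B ** Kc) (h * real k)"
  by (simp add: M_mat_def hold_flow_def matrix_mul_assoc)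

lemma mul_integral_mat_exp:
  assumes "0 \<le> t"
  shows "A ** integral {0..t} (\<lambda>\<tau>. mat_exp (\<tau> *\<^sub>R A)) = mat_exp (t *\<^sub>R A) - mat 1"
proof -
  have ftc: "((\<lambda>\<tau>. A ** mat_exp (\<tau> *\<^sub>R A)) has_integral mat_exp (t *\<^sub>R A) - mat_exp (0 *\<^sub>R A)) {0..t}"
    using assms by (intro fundamental_theorem_of_calculus mat_exp_has_vector_derivative)
  have "((\<lambda>\<tau>. mat_exp (\<tau> *\<^sub>R A)) has_integral
      integral {0..t} (\<lambda>\<tau>. mat_exp (\<tau> *\<^sub>R A))) {0..t}"
    by (intro integrable_integral integrable_continuous_interval continuous_on_mat_exp)
  from has_integral_linear[OF this bounded_linear_matrix_mul_left[of A]]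
  have "((\<lambda>\<tau>. A ** mat_exp (\<tau> *\<^sub>R A)) has_integral
      A ** integral {0..t} (\<lambda>\<tau>. mat_exp (\<tau> *\<^sub>R A))) {0..t}"
    by (simp add: o_def)
  from has_integral_unique[OF this ftc] show ?thesis
    by simp
qed

lemma hold_flow_has_vector_derivative:
  assumes t: "t \<in> {0..T}"
  shows "(hold_flow A D has_vector_derivative A ** hold_flow A D t + D) (at t within {0..T})"
proof -
  let ?E = "\<lambda>t. mat_exp (t *\<^sub>R A)"
  have "((\<lambda>t. ?E t + integral {0..t} ?E ** D) has_vector_derivative A ** ?E t + ?E t ** D)
      (at t within {0..T})"
    by (intro has_vector_derivative_add mat_exp_has_vector_derivative
        bounded_linear.has_vector_derivative[OF bounded_linear_matrix_mul_right]
        integral_has_vector_derivative continuous_on_mat_exp t)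
  moreover have "A ** ?E t + ?E t ** D = A ** hold_flow A D t + D"
  proof -
    have "A ** hold_flow A D t = A ** ?E t + (?E t - mat 1) ** D"
      using t by (simp add: hold_flow_def matrix_add_ldistrib matrix_mul_assoc mul_integral_mat_exp)
    also have "(?E t - mat 1) ** D = ?E t ** D - D"
      using linear_diff[OF bounded_linear.linear[OF bounded_linear_matrix_mul_right[of D]], of "?E t" "mat 1"] by simp
    finally show ?thesis by simp
  qed
  ultimately show ?thesis
    by (simp add: hold_flow_def[abs_def])
qed

lemma hold_flow_shift_has_vector_derivative:
  assumes s: "s \<in> {c..d}"
  shows "((\<lambda>s. hold_flow A D (s - c) *v x) has_vector_derivative
      A *v (hold_flow A D (s - c) *v x) + D *v x) (at s within {c..d})"
proof -
  have "((hold_flow A D \<circ> (\<lambda>s. s - c)) has_vector_derivative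
      1 *\<^sub>R (A ** hold_flow A D (s - c) + D)) (at s within {c..d})"
  proof (rule vector_diff_chain_within)
    show "((\<lambda>s. s - c) has_vector_derivative 1) (at s within {c..d})"
      by (auto intro!: derivative_eq_intros)
    show "(hold_flow A D has_vector_derivative A ** hold_flow A D (s - c) + D)
        (at (s - c) within (\<lambda>s. s - c) ` {c..d})"
      by (rule has_vector_derivative_within_subset[OF hold_flow_has_vector_derivative[where T = "d - c"]])
        (use s in auto)
  qed
  from bounded_linear.has_vector_derivative[OF bounded_linear_matrix_vector_mul_left this]
  show ?thesis
    by (simp add: o_def matrix_vector_mult_add_rdistrib matrix_vector_mul_assoc)
qed

section \<open>Existence of closed-loop solutions\<close>

locale petc =
  fixes A :: "real^'n^'n" and B :: "real^'u^'n" and Kc :: "real^'n^'u"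
    and Q :: "real^('n + 'n)^('n + 'n)" and h :: real and kbar :: nat
  assumes h_pos: "h > 0" and kbar_pos: "kbar \<ge> 1"
begin

abbreviation "M \<equiv> M_mat A B Kc h"
abbreviation "N \<equiv> N_mat A B Kc h Q"
abbreviation "\<kappa> \<equiv> kappa A B Kc h kbar Q"

definition step :: "real^'n \<Rightarrow> real^'n" where
  "step x = M (\<kappa> x) *v x"

lemma \<kappa>_in: "\<kappa> x \<in> {k \<in> {1..kbar}. qform (N k) x > 0 \<or> k = kbar}"
  unfolding kappa_def using kbar_pos by (intro Min_in) auto

definition sample_time :: "real^'n \<Rightarrow> nat \<Rightarrow> real" where
  "sample_time x i = (\<Sum>j<i. h * real (\<kappa> ((step ^^ j) x)))"

lemma sample_time_Suc: "sample_time x (Suc i) = sample_time x i + h * real (\<kappa> ((step ^^ i) x))"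
  by (simp add: sample_time_def)

lemma sample_time_step: "sample_time x i + h \<le> sample_time x (Suc i)"
  using \<kappa>_in[of "(step ^^ i) x"] h_pos by (simp add: sample_time_Suc)

lemma sample_time_strict_mono: "strict_mono (sample_time x)"
  unfolding strict_mono_Suc_iff
proof
  show "sample_time x i < sample_time x (Suc i)" for i
    using sample_time_step[of x i] h_pos by linarith
qed

lemma sample_time_ge: "h * real i \<le> sample_time x i"
proof (induction i)
  case (Suc i)
  then show ?case using sample_time_step[of x i] by (simp add: algebra_simps)
qed (simp add: sample_time_def)

definition sample_index :: "real^'n \<Rightarrow> real \<Rightarrow> nat" where
  "sample_index x s = (LEAST i. s < sample_time x (Suc i))"

lemma sample_index_eq:
  assumes "s \<in> {sample_time x i..<sample_time x (Suc i)}"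
  shows "sample_index x s = i"
  unfolding sample_index_def
proof (rule Least_equality)
  fix j assume "s < sample_time x (Suc j)"
  then have "sample_time x i < sample_time x (Suc j)" using assms by simp
  then show "i \<le> j"
    using strict_mono_less[OF sample_time_strict_mono] by (simp add: less_Suc_eq_le)
qed (use assms in simp)

definition held :: "real^'n \<Rightarrow> real \<Rightarrow> real^'n" where
  "held x s = (step ^^ sample_index x s) x"

definition traj :: "real^'n \<Rightarrow> real \<Rightarrow> real^'n" where
  "traj x s = hold_flow A (B ** Kc) (s - sample_time x (sample_index x s)) *v held x s"

lemma traj_sample_time: "traj x (sample_time x i) = (step ^^ i) x"
proof -
  have "sample_index x (sample_time x i) = i"
    using sample_time_step[of x i] h_pos by (intro sample_index_eq) simp
  then show ?thesis by (simp add: traj_def held_def)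
qed

lemma traj_eq:
  assumes "s \<in> {sample_time x i..sample_time x (Suc i)}"
  shows "traj x s = hold_flow A (B ** Kc) (s - sample_time x i) *v (step ^^ i) x"
proof (cases "s = sample_time x (Suc i)")
  case True
  then show ?thesis
    by (simp only: traj_sample_time) (simp add: sample_time_Suc step_def M_mat_eq_hold_flow)
next
  case False
  then have "sample_index x s = i" using assms by (intro sample_index_eq) auto
  then show ?thesis by (simp add: traj_def held_def)
qed

lemma traj_has_vector_derivative:
  assumes s: "s \<in> {sample_time x i..sample_time x (Suc i)}"
  shows "(traj x has_vector_derivative A *v traj x s + (B ** Kc) *v (step ^^ i) x)
      (at s within {sample_time x i..sample_time x (Suc i)})"
  unfolding traj_eq[OF s]
  by (rule has_vector_derivative_transform[OF s traj_eq hold_flow_shift_has_vector_derivative[OF s]])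

lemma continuous_on_traj: "continuous_on {0..} (traj x)"
proof -
  have upto: "continuous_on {0..sample_time x n} (traj x)" for n
  proof (induction n)
    case (Suc n)
    have "continuous_on {sample_time x n..sample_time x (Suc n)} (traj x)"
      unfolding continuous_on_eq_continuous_within
      by (intro ballI has_vector_derivative_continuous[OF traj_has_vector_derivative])
    with Suc have "continuous_on
        ({0..sample_time x n} \<union> {sample_time x n..sample_time x (Suc n)}) (traj x)"
      by (intro continuous_on_closed_Un) auto
    moreover have "0 \<le> sample_time x n"
      using h_pos by (simp add: sample_time_def sum_nonneg)
    then have "{0..sample_time x n} \<union> {sample_time x n..sample_time x (Suc n)}
        = {0..sample_time x (Suc n)}"
      using sample_time_step[of x n] h_pos by (intro ivl_disj_un_two_touch) auto
    ultimately show ?case by simp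
  qed (simp add: sample_time_def)
  show ?thesis
    unfolding continuous_on_eq_continuous_within
  proof
    fix s :: real assume s: "s \<in> {0..}"
    obtain n where n: "s / h < real n" using reals_Archimedean2 by blast
    then have "s < sample_time x n"
      using sample_time_ge[of n x] h_pos by (simp add: field_simps)
    then have "at s within {0..} = at s within {0..sample_time x n}"
      using s by (intro at_within_nhd[where S = "{..<sample_time x n}"]) auto
    moreover have "continuous (at s within {0..sample_time x n}) (traj x)"
      using upto[of n] s \<open>s < sample_time x n\<close> by (simp add: continuous_on_eq_continuous_within)
    ultimately show "continuous (at s within {0..}) (traj x)" by simp
  qed
qed

lemma petc_solution_traj: "petc_solution A B Kc h kbar Q (traj x) (held x) (sample_time x)"
  unfolding petc_solution_def
proof (intro conjI allI ballI)
  show "sample_time x 0 = 0"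
    by (simp add: sample_time_def)
  show "sample_time x (Suc i) = sample_time x i + h * real (\<kappa> (traj x (sample_time x i)))" for i
    by (simp only: sample_time_Suc traj_sample_time)
  show "continuous_on {0..} (traj x)"
    by (rule continuous_on_traj)
  fix i s assume s: "s \<in> {sample_time x i..<sample_time x (Suc i)}"
  have held_s: "held x s = (step ^^ i) x"
    unfolding held_def by (simp only: sample_index_eq[OF s])
  show "held x s = traj x (sample_time x i)"
    by (simp only: held_s traj_sample_time)
  show "(traj x has_vector_derivative A *v traj x s + (B ** Kc) *v held x s)
      (at s within {sample_time x i..sample_time x (Suc i)})"
    unfolding held_s by (rule traj_has_vector_derivative) (use s in simp)
qed

end

section \<open>Contraction of the Lyapunov function along event-triggered samples\<close>

lemma qform_scaleR: "qform P (c *\<^sub>R x) = c\<^sup>2 * qform P x"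
  by (simp add: qform_def matrix_vector_mult_scaleR power2_eq_square)

context petc
begin

lemma kappa_eqI:
  assumes "k \<in> {1..kbar}" "qform (N k) x > 0 \<or> k = kbar"
    and "\<And>j. 1 \<le> j \<Longrightarrow> j < k \<Longrightarrow> qform (N j) x \<le> 0"
  shows "\<kappa> x = k"
  unfolding kappa_def
proof (rule Min_eqI)
  fix j assume "j \<in> {k \<in> {1..kbar}. qform (N k) x > 0 \<or> k = kbar}"
  then show "k \<le> j" using assms(1) assms(3)[of j] by (cases "j < k") auto
qed (use assms in auto)

lemma qform_N_le_0:
  assumes "1 \<le> j" "j < \<kappa> x"
  shows "qform (N j) x \<le> 0"
proof (rule ccontr)
  assume "\<not> qform (N j) x \<le> 0"
  then have "\<kappa> x \<le> j"
    using assms \<kappa>_in[of x] unfolding kappa_def by (intro Min_le) auto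
  then show False using assms by simp
qed

lemma k_low_in: "k_low A B Kc h kbar Q \<in> {1..kbar}"
proof -
  have "k_low A B Kc h kbar Q \<in> {k \<in> {1..kbar}. \<not> neg_semidef (N k) \<or> k = kbar}"
    unfolding k_low_def using kbar_pos by (intro Min_in) auto
  then show ?thesis by simp
qed

lemma qform_N_below_k_low:
  assumes "1 \<le> j" "j < k_low A B Kc h kbar Q"
  shows "qform (N j) x \<le> 0"
proof (rule ccontr)
  assume "\<not> qform (N j) x \<le> 0"
  then have "k_low A B Kc h kbar Q \<le> j"
    using assms k_low_in unfolding k_low_def by (intro Min_le) (auto simp: neg_semidef_def)
  then show False using assms by simp
qed

lemma K_set_subset: "K_set A B Kc h kbar Q \<subseteq> {1..kbar}"
  using k_low_in by (auto simp: K_set_def)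

lemma \<kappa>_in_K_set: "\<kappa> x \<in> K_set A B Kc h kbar Q"
proof -
  have "k_low A B Kc h kbar Q \<le> \<kappa> x"
    using qform_N_below_k_low[of "\<kappa> x" x] \<kappa>_in[of x] k_low_in by force
  then show ?thesis using \<kappa>_in[of x] by (simp add: K_set_def)
qed

lemma Qk_set_iff:
  assumes k: "k \<in> K_set A B Kc h kbar Q"
  shows "z \<in> Qk_set A B Kc h kbar Q P k \<longleftrightarrow> z \<in> X0_set P \<and> \<kappa> z = k"
proof safe
  assume z: "z \<in> Qk_set A B Kc h kbar Q P k"
  then show X0: "z \<in> X0_set P"
    by (auto simp: Qk_set_def Kk_set_def split: if_splits)
  have k_range: "k \<in> {1..kbar}" using k K_set_subset by blast
  show "\<kappa> z = k"
  proof (rule kappa_eqI)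
    fix j assume j: "1 \<le> j" "j < k"
    show "qform (N j) z \<le> 0"
    proof (cases "j < k_low A B Kc h kbar Q")
      case False
      then have "z \<notin> Kk_set A B Kc h kbar Q P j" using z j by (auto simp: Qk_set_def)
      then show ?thesis using X0 j k_range by (auto simp: Kk_set_def)
    qed (use qform_N_below_k_low j in blast)
  qed (use z k_range in \<open>auto simp: Qk_set_def Kk_set_def split: if_splits\<close>)
next
  assume "z \<in> X0_set P"
  moreover have "z \<notin> Kk_set A B Kc h kbar Q P j" if "j \<in> {k_low A B Kc h kbar Q..<\<kappa> z}" for j
    using qform_N_le_0[of j z] \<kappa>_in[of z] that k_low_in by (auto simp: Kk_set_def)
  ultimately show "z \<in> Qk_set A B Kc h kbar Q P (\<kappa> z)"
    using \<kappa>_in[of z] by (auto simp: Qk_set_def Kk_set_def)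
qed

lemma \<kappa>_scaleR:
  assumes "c \<noteq> 0"
  shows "\<kappa> (c *\<^sub>R x) = \<kappa> x"
  using assms by (simp add: kappa_def qform_scaleR zero_less_mult_iff)

lemma step_scaleR: "step (c *\<^sub>R x) = c *\<^sub>R step x"
  by (cases "c = 0") (simp_all add: step_def \<kappa>_scaleR matrix_vector_mult_scaleR)

lemma funpow_step_scaleR: "(step ^^ i) (c *\<^sub>R x) = c *\<^sub>R (step ^^ i) x"
  by (induction i) (simp_all add: step_scaleR)

definition event_times :: "real^'n \<Rightarrow> nat \<Rightarrow> nat list" where
  "event_times x n = map (\<lambda>i. \<kappa> ((step ^^ i) x)) [0..<n]"

lemma length_event_times [simp]: "length (event_times x n) = n"
  by (simp add: event_times_def)

lemma nth_event_times [simp]: "i < n \<Longrightarrow> event_times x n ! i = \<kappa> ((step ^^ i) x)"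
  by (simp add: event_times_def)

lemma take_event_times: "i \<le> n \<Longrightarrow> take i (event_times x n) = event_times x i"
  by (simp add: event_times_def take_map)

lemma event_times_Suc: "event_times x (Suc n) = event_times x n @ [\<kappa> ((step ^^ n) x)]"
  by (simp add: event_times_def)

lemma event_times_Cons: "event_times x (Suc n) = \<kappa> x # event_times (step x) n"
  by (simp add: event_times_def upt_conv_Cons map_Suc_upt[symmetric] funpow_swap1 o_def
      del: upt_Suc)

lemma event_times_scaleR: "c \<noteq> 0 \<Longrightarrow> event_times (c *\<^sub>R x) n = event_times x n"
  by (simp add: event_times_def funpow_step_scaleR \<kappa>_scaleR)

lemma propagate_event_times: "propagate A B Kc h (event_times x n) x = (step ^^ n) x"
proof (induction n)
  case (Suc n)
  then show ?case
    by (simp add: event_times_Suc propagate_def step_def[of "(step ^^ n) x"])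
qed (simp add: event_times_def propagate_def)

lemma set_event_times: "set (event_times x n) \<subseteq> K_set A B Kc h kbar Q"
  using \<kappa>_in_K_set by (auto simp: event_times_def)

lemma event_times_unique:
  assumes \<sigma>: "set \<sigma> \<subseteq> K_set A B Kc h kbar Q"
    and Qk: "\<And>i. i < length \<sigma> \<Longrightarrow>
      propagate A B Kc h (take i \<sigma>) z \<in> Qk_set A B Kc h kbar Q P (\<sigma> ! i)"
  shows "\<sigma> = event_times z (length \<sigma>)"
proof -
  have "take i \<sigma> = event_times z i" if "i \<le> length \<sigma>" for i
    using that
  proof (induction i)
    case (Suc i)
    then have "\<sigma> ! i \<in> K_set A B Kc h kbar Q"
      using \<sigma> nth_mem[of i \<sigma>] by auto
    with Suc show ?case
      using Qk[of i] by (simp add: take_Suc_conv_app_nth event_times_Suc Qk_set_iff propagate_event_times)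
  qed (simp add: event_times_def)
  from this[of "length \<sigma>"] show ?thesis by simp
qed

end

lemma power_horizon_le:
  assumes "0 < r" "r < 1" "0 \<le> a" "a < 1"
  shows "a ^ horizon a r \<le> r"
proof (cases "a = 0")
  case False
  then have a: "0 < a" "ln a < 0" using assms by auto
  have "log a r \<le> real (horizon a r)"
    using False by (simp add: horizon_def) linarith
  then have "real (horizon a r) * ln a \<le> ln r"
    using a by (simp add: log_def field_simps)
  then have "ln (a ^ horizon a r) \<le> ln r"
    using a by (simp add: ln_realpow)
  then show ?thesis using a assms by simp
qed (use assms in \<open>simp add: horizon_def\<close>)

locale petc_contraction = petc A B Kc Q h kbar
  for A :: "real^'n^'n" and B :: "real^'u^'n" and Kc Q h kbar +
  fixes P :: "real^'n^'n" and a r :: real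
  assumes pos_def: "pos_def P" and r: "0 < r" "r < 1" and a: "0 \<le> a" "a < 1"
    and contraction: "qform P (step x) \<le> a * qform P x"
begin

abbreviation "R \<equiv> R_rel A B Kc h kbar Q P a r"

lemma qform_pos: "x \<noteq> 0 \<Longrightarrow> 0 < qform P x"
  using pos_def by (simp add: pos_def_def)

lemma qform_nonneg: "0 \<le> qform P x"
  using qform_pos[of x] by (cases "x = 0") (auto simp: qform_def)

lemma qform_funpow_step_le: "qform P ((step ^^ i) x) \<le> a ^ i * qform P x"
proof (induction i)
  case (Suc i)
  have "qform P ((step ^^ Suc i) x) \<le> a * qform P ((step ^^ i) x)"
    using contraction by simp
  also have "\<dots> \<le> a * (a ^ i * qform P x)"
    using Suc a(1) by (rule mult_left_mono)
  finally show ?case by (simp add: mult.assoc)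
qed simp

lemma qform_funpow_step_horizon: "qform P ((step ^^ horizon a r) x) \<le> r * qform P x"
  using qform_funpow_step_le[of "horizon a r" x] power_horizon_le[OF r a]
    mult_right_mono[OF _ qform_nonneg[of x]] order_trans by blast

definition entry_index :: "real^'n \<Rightarrow> nat" where
  "entry_index x = (LEAST i. qform P ((step ^^ i) x) \<le> r * qform P x)"

lemma entry_index_reached: "qform P ((step ^^ entry_index x) x) \<le> r * qform P x"
  unfolding entry_index_def using qform_funpow_step_horizon by (rule LeastI)

lemma not_reached_before: "i < entry_index x \<Longrightarrow> \<not> qform P ((step ^^ i) x) \<le> r * qform P x"
  unfolding entry_index_def by (rule not_less_Least)

lemma entry_index_le: "qform P ((step ^^ i) x) \<le> r * qform P x \<Longrightarrow> entry_index x \<le> i"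
  unfolding entry_index_def by (rule Least_le)

lemma entry_index_in:
  assumes "x \<noteq> 0"
  shows "entry_index x \<in> {1..horizon a r}"
proof -
  have "entry_index x \<noteq> 0"
  proof
    assume "entry_index x = 0"
    then have "qform P x \<le> r * qform P x" using entry_index_reached[of x] by simp
    then show False using qform_pos[OF assms] r by simp
  qed
  then show ?thesis using entry_index_le[OF qform_funpow_step_horizon, of x] by simp
qed

lemma entry_index_step: "entry_index x \<le> Suc (entry_index (step x))"
proof (rule entry_index_le)
  have "qform P (step x) \<le> 1 * qform P x"
    using contraction[of x] mult_right_mono[OF less_imp_le[OF a(2)] qform_nonneg[of x]] by linarith
  then have "r * qform P (step x) \<le> r * qform P x"
    using r by simp
  then show "qform P ((step ^^ Suc (entry_index (step x))) x) \<le> r * qform P x"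
    using entry_index_reached[of "step x"] by (simp add: funpow_swap1)
qed

text \<open>By homogeneity the normalisation of the initial state does not affect the event times, so
  a state has exactly one related sequence.\<close>

lemma R_iff:
  assumes "x \<noteq> 0"
  shows "(x, \<sigma>) \<in> R \<longleftrightarrow> \<sigma> = event_times x (entry_index x)"
proof -
  define c where "c = 1 / sqrt (qform P x)"
  define z where "z = c *\<^sub>R x"
  have V: "0 < qform P x" by (rule qform_pos[OF assms])
  have c: "c \<noteq> 0" using V by (simp add: c_def)
  have qz: "qform P ((step ^^ i) z) = qform P ((step ^^ i) x) / qform P x" for i
    using V by (simp add: z_def c_def funpow_step_scaleR qform_scaleR power_divide)
  have XP: "(step ^^ i) z \<in> XP_set P r \<longleftrightarrow> qform P ((step ^^ i) x) \<le> r * qform P x" for i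
    using V by (simp add: XP_set_def qz field_simps)
  have X0: "(step ^^ i) z \<in> X0_set P" for i
  proof -
    have "qform P ((step ^^ i) x) \<le> a ^ i * qform P x"
      by (rule qform_funpow_step_le)
    also have "\<dots> \<le> 1 * qform P x"
      using a V by (intro mult_right_mono power_le_one) auto
    finally show ?thesis
      using V by (simp add: X0_set_def qz)
  qed
  have ev: "event_times z n = event_times x n" for n
    by (simp add: z_def event_times_scaleR[OF c])
  have R: "(x, \<sigma>) \<in> R \<longleftrightarrow> \<sigma> \<in> KN_set (K_set A B Kc h kbar Q) (horizon a r) \<and>
      z \<in> X0_set P \<and>
      (\<forall>i<length \<sigma>. propagate A B Kc h (take i \<sigma>) z \<in> Qk_set A B Kc h kbar Q P (\<sigma> ! i)) \<and>
      z \<notin> XP_set P r \<and>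
      (\<forall>i<length \<sigma>. propagate A B Kc h (take i \<sigma>) z \<notin> XP_set P r) \<and>
      propagate A B Kc h \<sigma> z \<in> XP_set P r"
    by (simp add: R_rel_def Let_def z_def c_def inverse_eq_divide)
  show ?thesis
  proof
    assume xR: "(x, \<sigma>) \<in> R"
    have \<sigma>: "\<sigma> = event_times z (length \<sigma>)"
      using xR unfolding R by (intro event_times_unique) (auto simp: KN_set_def)
    have orbit: "propagate A B Kc h (take i \<sigma>) z = (step ^^ i) z" if "i \<le> length \<sigma>" for i
      using that by (subst \<sigma>) (simp add: take_event_times propagate_event_times)
    have "entry_index x \<le> length \<sigma>"
      using xR orbit[of "length \<sigma>"] unfolding R by (intro entry_index_le) (simp add: XP)
    moreover have "length \<sigma> \<le> entry_index x"
      using xR orbit entry_index_reached[of x] unfolding R XP[symmetric]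
      by (metis less_imp_le not_le_imp_less)
    ultimately show "\<sigma> = event_times x (entry_index x)"
      using \<sigma> ev by (metis le_antisym)
  next
    assume "\<sigma> = event_times x (entry_index x)"
    then have \<sigma>: "\<sigma> = event_times z (entry_index x)" by (simp add: ev)
    have orbit: "propagate A B Kc h (take i \<sigma>) z = (step ^^ i) z" if "i \<le> entry_index x" for i
      using that by (simp add: \<sigma> take_event_times propagate_event_times)
    have "\<sigma> \<in> KN_set (K_set A B Kc h kbar Q) (horizon a r)"
      using entry_index_in[OF assms] set_event_times[of z] by (auto simp: KN_set_def \<sigma>)
    moreover have "propagate A B Kc h \<sigma> z \<in> XP_set P r"
      using entry_index_reached[of x] by (simp add: \<sigma> propagate_event_times XP)
    moreover have "z \<notin> XP_set P r"
      using XP[of 0] V r by simp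
    moreover have "z \<in> X0_set P" using X0[of 0] by simp
    ultimately show "(x, \<sigma>) \<in> R"
      unfolding R using orbit not_reached_before[of _ x] X0
      by (auto simp: \<sigma> Qk_set_iff[OF \<kappa>_in_K_set] XP)
  qed
qed

lemma R_imp_nonzero: "(x, \<sigma>) \<in> R \<Longrightarrow> x \<noteq> 0"
  using r by (auto simp: R_rel_def Let_def XP_set_def qform_def)

lemma XS_iff: "\<sigma> \<in> XS_set A B Kc h kbar Q P a r \<longleftrightarrow>
    (\<exists>x. x \<noteq> 0 \<and> \<sigma> = event_times x (entry_index x))"
proof -
  have "\<sigma> \<in> XS_set A B Kc h kbar Q P a r \<longleftrightarrow> (\<exists>x. (x, \<sigma>) \<in> R)"
    by (auto simp: XS_set_def R_rel_def)
  then show ?thesis using R_iff R_imp_nonzero by metis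
qed

lemma event_times_in_XS:
  "x \<noteq> 0 \<Longrightarrow> event_times x (entry_index x) \<in> XS_set A B Kc h kbar Q P a r"
  by (auto simp: XS_iff)

lemma event_times_entry_index:
  assumes "x \<noteq> 0"
  shows "event_times x (entry_index x) = \<kappa> x # event_times (step x) (entry_index x - 1)"
  using entry_index_in[OF assms] event_times_Cons[of x "entry_index x - 1"] by simp

lemma out_set_kappa: "h * real (\<kappa> x) \<in> out_set h kbar hP"
  using \<kappa>_in[of x] by (auto simp: out_set_def)

lemma simulation_relation_R:
  "simulation_relation R (petc_traffic_nz A B Kc h kbar Q hP) (S_abs A B Kc h kbar Q P a r hP)"
proof -
  let ?X = "XS_set A B Kc h kbar Q P a r"
  have HS: "HS h hP (event_times x (entry_index x)) = h * real (\<kappa> x)" if "x \<noteq> 0" for x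
    by (simp add: event_times_entry_index[OF that])
  have sys: "is_system (petc_traffic_nz A B Kc h kbar Q hP)"
    by (auto simp: is_system_def petc_traffic_nz_def restrict_system_def petc_traffic_def
        out_set_kappa)
  have sys': "is_system (S_abs A B Kc h kbar Q P a r hP)"
    by (auto simp: is_system_def S_abs_def Let_def XS_iff HS out_set_kappa)
  have edge: "\<exists>\<sigma>'. (\<sigma>, \<sigma>') \<in> sys_edges (S_abs A B Kc h kbar Q P a r hP) \<and> (step x, \<sigma>') \<in> R"
    if \<sigma>: "(x, \<sigma>) \<in> R" and nz: "step x \<noteq> 0" for x \<sigma>
  proof -
    have x: "x \<noteq> 0" by (rule R_imp_nonzero[OF \<sigma>])
    define \<tau> where "\<tau> = event_times (step x) (entry_index x - 1)"
    define \<rho> where "\<rho> = event_times (step x) (entry_index (step x))"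
    have \<sigma>_eq: "\<sigma> = \<kappa> x # \<tau>"
      using R_iff[OF x] \<sigma> by (simp add: \<tau>_def event_times_entry_index[OF x])
    have "\<tau> = take (entry_index x - 1) \<rho>"
      unfolding \<tau>_def \<rho>_def using entry_index_step[of x] by (simp add: take_event_times)
    then obtain \<sigma>' where \<rho>: "\<rho> = \<tau> @ \<sigma>'"
      by (metis append_take_drop_id)
    have "\<kappa> x # \<tau> \<in> ?X"
      using event_times_in_XS[OF x] by (simp add: \<tau>_def event_times_entry_index[OF x])
    moreover have "\<tau> @ \<sigma>' \<in> ?X"
      using event_times_in_XS[OF nz] \<rho> by (simp add: \<rho>_def)
    ultimately have "(\<sigma>, \<rho>) \<in> sys_edges (S_abs A B Kc h kbar Q P a r hP)"
      using \<kappa>_in_K_set[of x] by (auto simp: S_abs_def Let_def \<sigma>_eq \<rho>)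
    moreover have "(step x, \<rho>) \<in> R" using R_iff[OF nz] by (simp add: \<rho>_def)
    ultimately show ?thesis by blast
  qed
  show ?thesis
    unfolding simulation_relation_def
  proof (intro conjI)
    show "is_system (petc_traffic_nz A B Kc h kbar Q hP)" by (rule sys)
    show "is_system (S_abs A B Kc h kbar Q P a r hP)" by (rule sys')
    show "sys_outputs (petc_traffic_nz A B Kc h kbar Q hP)
        = sys_outputs (S_abs A B Kc h kbar Q P a r hP)"
      by (simp add: petc_traffic_nz_def restrict_system_def petc_traffic_def S_abs_def Let_def)
    show "R \<subseteq> sys_states (petc_traffic_nz A B Kc h kbar Q hP)
        \<times> sys_states (S_abs A B Kc h kbar Q P a r hP)"
    proof clarify
      fix x \<sigma> assume "(x, \<sigma>) \<in> R"
      then show "x \<in> sys_states (petc_traffic_nz A B Kc h kbar Q hP) \<and>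
          \<sigma> \<in> sys_states (S_abs A B Kc h kbar Q P a r hP)"
        using R_imp_nonzero[of x \<sigma>] R_iff[of x \<sigma>] event_times_in_XS[of x]
        by (auto simp: petc_traffic_nz_def restrict_system_def petc_traffic_def S_abs_def Let_def)
    qed
    show "\<forall>x\<in>sys_init (petc_traffic_nz A B Kc h kbar Q hP).
        \<exists>\<sigma>\<in>sys_init (S_abs A B Kc h kbar Q P a r hP). (x, \<sigma>) \<in> R"
      using R_iff event_times_in_XS
      by (auto simp: petc_traffic_nz_def restrict_system_def petc_traffic_def S_abs_def Let_def)
    show "\<forall>(x, \<sigma>)\<in>R. sys_map (petc_traffic_nz A B Kc h kbar Q hP) x
        = sys_map (S_abs A B Kc h kbar Q P a r hP) \<sigma>"
    proof clarify
      fix x \<sigma> assume "(x, \<sigma>) \<in> R"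
      then show "sys_map (petc_traffic_nz A B Kc h kbar Q hP) x
          = sys_map (S_abs A B Kc h kbar Q P a r hP) \<sigma>"
        using R_imp_nonzero[of x \<sigma>] R_iff[of x \<sigma>] HS[of x]
        by (simp add: petc_traffic_nz_def restrict_system_def petc_traffic_def S_abs_def Let_def)
    qed
    show "\<forall>(x, \<sigma>)\<in>R. \<forall>x'. (x, x') \<in> sys_edges (petc_traffic_nz A B Kc h kbar Q hP) \<longrightarrow>
        (\<exists>\<sigma>'. (\<sigma>, \<sigma>') \<in> sys_edges (S_abs A B Kc h kbar Q P a r hP) \<and> (x', \<sigma>') \<in> R)"
      using edge
      by (fastforce simp: petc_traffic_nz_def restrict_system_def petc_traffic_def step_def)
  qed
qed

end

theorem theorem2:
  fixes A :: "real^'n^'n" and B :: "real^'u^'n" and Kc :: "real^'n^'u"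
    and Q :: "real^('n + 'n)^('n + 'n)" and P :: "real^'n^'n"
    and h hP a r :: real and kbar :: nat
  assumes "h > 0" and "kbar \<ge> 1" and "hP > 0" and "symmetric_mat Q"
    and "symmetric_mat P" and "pos_def P"
    and "0 < r" and "r < 1"
    and "petc_GES A B Kc h kbar Q"
    and "0 \<le> a" and "a < 1"
    and "\<And>\<xi> \<xi>h t i. petc_solution A B Kc h kbar Q \<xi> \<xi>h t \<Longrightarrow>
           qform P (\<xi> (t (Suc i))) \<le> a * qform P (\<xi> (t i))"
  shows "\<exists>R. simulation_relation R
           (petc_traffic_nz A B Kc h kbar Q hP) (S_abs A B Kc h kbar Q P a r hP)"
proof -
  interpret petc A B Kc Q h kbar
    by unfold_locales (fact assms)+
  have "qform P (step x) \<le> a * qform P x" for x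
    using assms(12)[OF petc_solution_traj[of x], of 0] by (simp only: traj_sample_time) simp
  then interpret petc_contraction A B Kc Q h kbar P a r
    by unfold_locales (use assms in auto)
  show ?thesis
    using simulation_relation_R by blast
qed

end
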